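(* Let $(\gamma_s,f_1,f_2):I\to AdS^3\times\Delta_1$ be a pseudo-spherical spacelike framed immersion with curvature $(\alpha,\hat\ell,0,\hat n)$, with $\hat n\neq0$, $\alpha^2+\hat\epsilon\hat n^2\ne0$ and $g:=\hat\epsilon(\alpha\hat n'-\hat n\alpha')^2-\hat\ell^2\hat n^2(\hat n^2+\hat\epsilon\alpha^2)\neq0$ on $I$. Let $F^T:I\times AdS^3\to\mathbb{R}$ and $F^S:I\times S^3_2\to\mathbb{R}$ be given by $F^T(s,\mathbf{v})=\langle\mu(s),\mathbf{v}\rangle$ and $F^S(s,\mathbf{v})=\langle\mu(s),\mathbf{v}\rangle$. Let $s_0\in I$. (i) Suppose $g(s_0)<0$ and let $\mathbf{v}_0\in AdS^3$. (a) $F^T(s_0,\mathbf{v}_0)=0$ if and only if there exist $a,b,c\in\mathbb{R}$ with $\mathbf{v}_0=a\gamma_s(s_0)+bf_1(s_0)+cf_2(s_0)$ and $-a^2+\hat\epsilon b^2-\hat\epsilon c^2=-1$. (b) $F^T(s_0,\mathbf{v}_0)=\frac{\partial F^T}{\partial s}(s_0,\mathbf{v}_0)=0$ if and only if there exist $a,b\in\mathbb{R}$ with $\mathbf{v}_0=a\gamma_s(s_0)+bf_1(s_0)-\frac{a\alpha(s_0)}{\hat n(s_0)}f_2(s_0)$ and $\hat n^2(s_0)(1+\hat\epsilon b^2)=a^2(\hat n^2(s_0)+\hat\epsilon\alpha^2(s_0))$. (c) $F^T(s_0,\mathbf{v}_0)=\frac{\partial F^T}{\partial s}(s_0,\mathbf{v}_0)=\frac{\partial^2F^T}{\partial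 s^2}(s_0,\mathbf{v}_0)=0$ if and only if $\mathbf{v}_0=\mathcal{E}_a(\gamma_s)(s_0)$ (for one of the two signs). (ii) Suppose $g(s_0)>0$ and let $\mathbf{v}_0\in S^3_2$. (a) $F^S(s_0,\mathbf{v}_0)=0$ if and only if there exist $a,b,c\in\mathbb{R}$ with $\mathbf{v}_0=a\gamma_s(s_0)+bf_1(s_0)+cf_2(s_0)$ and $-a^2+\hat\epsilon b^2-\hat\epsilon c^2=1$. (b) $F^S(s_0,\mathbf{v}_0)=\frac{\partial F^S}{\partial s}(s_0,\mathbf{v}_0)=0$ if and only if there exist $a,b\in\mathbb{R}$ with $\mathbf{v}_0=a\gamma_s(s_0)+bf_1(s_0)-\frac{a\alpha(s_0)}{\hat n(s_0)}f_2(s_0)$ and $\hat n^2(s_0)(\hat\epsilon b^2-1)=a^2(\hat n^2(s_0)+\hat\epsilon\alpha^2(s_0))$; if $\hat\epsilon=-1$, then necessarily $\hat n^2(s_0)<\alpha^2(s_0)$. (c) $F^S(s_0,\mathbf{v}_0)=\frac{\partial F^S}{\partial s}(s_0,\mathbf{v}_0)=\frac{\partial^2F^S}{\partial s^2}(s_0,\mathbf{v}_0)=0$ if and only if $\mathbf{v}_0=\mathcal{E}_p(\gamma_s)(s_0)$ (for one of the two signs).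
   Context: $\mathbb{R}^4_2$ is $\mathbb{R}^4$ with $\langle u,w\rangle=-u_1w_1-u_2w_2+u_3w_3+u_4w_4$; the triple product $u\times v\times w$ is the unique vector with $\langle x,u\times v\times w\rangle=\det(x,u,v,w)$ for all $x$. $AdS^3=\{u:\langle u,u\rangle=-1\}$, $S^3_2=\{u:\langle u,u\rangle=1\}$, and $\Delta_1=\{(u,w):\langle u,w\rangle=0\}\subset AdS^3\times S^3_2$ (or $\subset S^3_2\times AdS^3$). A pseudo-spherical spacelike framed immersion $(\gamma_s,f_1,f_2):I\to AdS^3\times\Delta_1$ is a smooth immersion with $\langle\gamma_s,f_i\rangle=\langle\gamma_s',f_i\rangle=0$, $i=1,2$. Here it has curvature $(\alpha,\hat\ell,0,\hat n)$, meaning that with $\mu=\gamma_s\times f_1\times f_2$ and $\hat\epsilon=\langle f_1,f_1\rangle\in\{\pm1\}$ (so $\langle f_2,f_2\rangle=-\hat\epsilon$), $$\gamma_s'=\alpha\mu,\quad f_1'=\hat\ell f_2,\quad f_2'=\hat\ell f_1+\hat n\mu,\quad \mu'=\alpha\gamma_s+\hat\epsilon\hat n f_2 .$$ The total evolute is $$\mathcal{E}(\gamma_s)=\pm\frac{\hat\ell\hat n(\hat n\gamma_s-\alpha f_2)-(\alpha\hat n'-\hat n\alpha')f_1}{\sqrt{|g|}} ;$$ it is denoted $\mathcal{E}_a(\gamma_s)$ (lying in $AdS^3$) where $g<0$ and $\mathcal{E}_p(\gamma_s)$ (lying in $S^3_2$) where $g>0$. *)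

theory Defs
  imports "HOL-Analysis.Analysis"
begin

section \<open>The semi-Euclidean space of dimension 4 and index 2\<close>

definition pinner :: "real^4 \<Rightarrow> real^4 \<Rightarrow> real" where
  "pinner u w = - u$1 * w$1 - u$2 * w$2 + u$3 * w$3 + u$4 * w$4"

text \<open>The matrix below has the rows \<open>x\<close>, \<open>u\<close>, \<open>v\<close>, \<open>w\<close>; existence and uniqueness of the
  described vector are established in \<open>triple_prod_unique\<close>.\<close>

definition triple_prod :: "real^4 \<Rightarrow> real^4 \<Rightarrow> real^4 \<Rightarrow> real^4" where
  "triple_prod u v w =
     (THE z. \<forall>x. pinner x z = det (vector [x, u, v, w] :: real^4^4))"

definition AdS3 :: "(real^4) set" where
  "AdS3 = {u. pinner u u = -1}"

definition S32 :: "(real^4) set" where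
  "S32 = {u. pinner u u = 1}"

definition Delta1 :: "((real^4) \<times> (real^4)) set" where
  "Delta1 = {(u, w). (u \<in> AdS3 \<and> w \<in> S32 \<or> u \<in> S32 \<and> w \<in> AdS3) \<and> pinner u w = 0}"

lemma vector_4 [simp]:
  "(vector [x, y, z, t] :: 'a::zero^4) $ 1 = x"
  "(vector [x, y, z, t] :: 'a::zero^4) $ 2 = y"
  "(vector [x, y, z, t] :: 'a::zero^4) $ 3 = z"
  "(vector [x, y, z, t] :: 'a::zero^4) $ 4 = t"
  unfolding vector_def by simp_all

lemma det_vector_4_first:
  fixes x u v w :: "real^4"
  shows "det (vector [x, u, v, w] :: real^4^4) =
         (\<Sum>j\<in>UNIV. x$j * det (vector [axis j 1, u, v, w] :: real^4^4))"
proof -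
  define M :: "real^4 \<Rightarrow> real^4^4"
    where "M = (\<lambda>y. \<chi> i. if i = 1 then y else (vector [0, u, v, w] :: real^4^4) $ i)"
  have M: "(vector [y, u, v, w] :: real^4^4) = M y" for y
    by (simp add: vec_eq_iff[where 'b = 4] M_def forall_4)
  have "x = (\<Sum>j\<in>UNIV. x$j *s axis j 1)"
    by (simp add: basis_expansion)
  then have "det (M x) = det (M (\<Sum>j\<in>UNIV. x$j *s axis j 1))"
    by simp
  also have "\<dots> = (\<Sum>j\<in>UNIV. det (M (x$j *s axis j 1)))"
    unfolding M_def by (rule det_linear_row_sum) simp
  also have "\<dots> = (\<Sum>j\<in>UNIV. x$j * det (M (axis j 1)))"
    unfolding M_def by (simp only: det_row_mul)
  finally show ?thesis by (simp only: M)
qed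

lemma triple_prod_unique:
  "\<exists>!z. \<forall>x. pinner x z = det (vector [x, u, v, w] :: real^4^4)"
proof (rule ex1I)
  let ?d = "\<lambda>j. det (vector [axis j 1, u, v, w] :: real^4^4)"
  show "\<forall>x. pinner x (vector [- ?d 1, - ?d 2, ?d 3, ?d 4])
          = det (vector [x, u, v, w] :: real^4^4)"
    by (subst det_vector_4_first) (simp add: pinner_def sum_4)
  fix z assume z: "\<forall>x. pinner x z = det (vector [x, u, v, w] :: real^4^4)"
  have "pinner (axis j 1) z = ?d j" for j
    using z by blast
  from this[of 1] this[of 2] this[of 3] this[of 4]
  show "z = vector [- ?d 1, - ?d 2, ?d 3, ?d 4]"
    by (simp add: pinner_def axis_def vec_eq_iff forall_4)
qed

lemma pinner_triple_prod:
  "pinner x (triple_prod u v w) = det (vector [x, u, v, w] :: real^4^4)"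
  unfolding triple_prod_def using theI'[OF triple_prod_unique[of u v w]] by blast

section \<open>Smooth maps on an interval\<close>

text \<open>Derivatives are taken within \<open>I\<close>, hence one-sided at an endpoint belonging to \<open>I\<close>
  and the usual ones everywhere else.\<close>

primrec nth_deriv_on :: "real set \<Rightarrow> nat \<Rightarrow> (real \<Rightarrow> 'a::real_normed_vector) \<Rightarrow> real \<Rightarrow> 'a"
where
  "nth_deriv_on I 0 f = f"
| "nth_deriv_on I (Suc k) f = (\<lambda>s. vector_derivative (nth_deriv_on I k f) (at s within I))"

definition smooth_map_on :: "real set \<Rightarrow> (real \<Rightarrow> 'a::real_normed_vector) \<Rightarrow> bool" where
  "smooth_map_on I f \<longleftrightarrow> (\<forall>k. \<forall>s\<in>I. nth_deriv_on I k f differentiable (at s within I))"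

section \<open>Spacelike framed immersions\<close>

text \<open>The immersion condition concerns the map \<open>(\<gamma>, f1, f2)\<close>; the curve \<open>\<gamma>\<close> itself may be
  singular.\<close>

definition framed_immersion ::
  "real set \<Rightarrow> (real \<Rightarrow> real^4) \<Rightarrow> (real \<Rightarrow> real^4) \<Rightarrow> (real \<Rightarrow> real^4) \<Rightarrow> bool" where
  "framed_immersion I \<gamma> f1 f2 \<longleftrightarrow>
     (\<forall>s\<in>I. \<gamma> s \<in> AdS3 \<and> (f1 s, f2 s) \<in> Delta1) \<and>
     smooth_map_on I (\<lambda>s. (\<gamma> s, f1 s, f2 s)) \<and>
     (\<forall>s\<in>I. nth_deriv_on I 1 (\<lambda>s. (\<gamma> s, f1 s, f2 s)) s \<noteq> 0) \<and>
     (\<forall>s\<in>I. pinner (\<gamma> s) (f1 s) = 0 \<and> pinner (\<gamma> s) (f2 s) = 0 \<and>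
            pinner (nth_deriv_on I 1 \<gamma> s) (f1 s) = 0 \<and>
            pinner (nth_deriv_on I 1 \<gamma> s) (f2 s) = 0)"

definition mu ::
  "(real \<Rightarrow> real^4) \<Rightarrow> (real \<Rightarrow> real^4) \<Rightarrow> (real \<Rightarrow> real^4) \<Rightarrow> real \<Rightarrow> real^4" where
  "mu \<gamma> f1 f2 s = triple_prod (\<gamma> s) (f1 s) (f2 s)"

text \<open>The curvature is \<open>(\<alpha>, l, 0, n)\<close>, and \<open>\<epsilon>\<close> is the causal sign of \<open>f1\<close>. By the definition
  of \<open>Delta1\<close> the sign is \<open>1\<close> or \<open>-1\<close>, and by continuity it does not depend on the
  parameter.\<close>

definition has_curvature ::
  "real set \<Rightarrow> (real \<Rightarrow> real^4) \<Rightarrow> (real \<Rightarrow> real^4) \<Rightarrow> (real \<Rightarrow> real^4) \<Rightarrow> real \<Rightarrow>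
   (real \<Rightarrow> real) \<Rightarrow> (real \<Rightarrow> real) \<Rightarrow> (real \<Rightarrow> real) \<Rightarrow> bool" where
  "has_curvature I \<gamma> f1 f2 \<epsilon> \<alpha> l n \<longleftrightarrow>
     (\<forall>s\<in>I. pinner (f1 s) (f1 s) = \<epsilon>) \<and>
     (\<forall>s\<in>I.
       (\<gamma> has_vector_derivative \<alpha> s *\<^sub>R mu \<gamma> f1 f2 s) (at s within I) \<and>
       (f1 has_vector_derivative l s *\<^sub>R f2 s) (at s within I) \<and>
       (f2 has_vector_derivative l s *\<^sub>R f1 s + n s *\<^sub>R mu \<gamma> f1 f2 s) (at s within I) \<and>
       (mu \<gamma> f1 f2 has_vector_derivative \<alpha> s *\<^sub>R \<gamma> s + (\<epsilon> * n s) *\<^sub>R f2 s) (at s within I))"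

definition g_fun ::
  "real set \<Rightarrow> real \<Rightarrow> (real \<Rightarrow> real) \<Rightarrow> (real \<Rightarrow> real) \<Rightarrow> (real \<Rightarrow> real) \<Rightarrow> real \<Rightarrow> real" where
  "g_fun I \<epsilon> \<alpha> l n s =
     \<epsilon> * (\<alpha> s * nth_deriv_on I 1 n s - n s * nth_deriv_on I 1 \<alpha> s)\<^sup>2
     - (l s)\<^sup>2 * (n s)\<^sup>2 * ((n s)\<^sup>2 + \<epsilon> * (\<alpha> s)\<^sup>2)"

text \<open>The parameter \<open>\<sigma>\<close>, equal to \<open>1\<close> or \<open>-1\<close>, is the sign in front of the total evolute.\<close>

definition total_evolute ::
  "real set \<Rightarrow> real \<Rightarrow> real \<Rightarrow> (real \<Rightarrow> real^4) \<Rightarrow> (real \<Rightarrow> real^4) \<Rightarrow> (real \<Rightarrow> real^4) \<Rightarrow>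
   (real \<Rightarrow> real) \<Rightarrow> (real \<Rightarrow> real) \<Rightarrow> (real \<Rightarrow> real) \<Rightarrow> real \<Rightarrow> real^4" where
  "total_evolute I \<sigma> \<epsilon> \<gamma> f1 f2 \<alpha> l n s =
     (\<sigma> / sqrt \<bar>g_fun I \<epsilon> \<alpha> l n s\<bar>) *\<^sub>R
       ((l s * n s) *\<^sub>R (n s *\<^sub>R \<gamma> s - \<alpha> s *\<^sub>R f2 s)
        - (\<alpha> s * nth_deriv_on I 1 n s - n s * nth_deriv_on I 1 \<alpha> s) *\<^sub>R f1 s)"

text \<open>\<open>F\<^sup>T\<close> and \<open>F\<^sup>S\<close> are the restrictions of the following function to \<open>v \<in> AdS3\<close> and
  \<open>v \<in> S32\<close>, respectively.\<close>

definition height ::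
  "(real \<Rightarrow> real^4) \<Rightarrow> (real \<Rightarrow> real^4) \<Rightarrow> (real \<Rightarrow> real^4) \<Rightarrow> real \<Rightarrow> real^4 \<Rightarrow> real" where
  "height \<gamma> f1 f2 s v = pinner (mu \<gamma> f1 f2 s) v"

end

(* The frame gamma, f1, f2, mu is pseudo-orthonormal, so every v equals
   a gamma + b f1 + c f2 + d mu with coefficients given by inner products. In these coefficients
   F = d, and F = 0 gives F' = -(alpha a + n c) and F'' = n l b - alpha' a - n' c. The linear
   system F = F' = F'' = 0 has a one-dimensional solution space, spanned by the numerator of the
   total evolute, whose square norm is g; normalising v leaves the two signs. *)

theory Submission
  imports Defs
begin

section \<open>Linear algebra of the index-2 inner product and the triple product\<close>

lemma det_4:
  fixes A :: "'a::comm_ring_1^4^4"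
  shows "det A =
    A$1$1 * (A$2$2 * (A$3$3 * A$4$4 - A$3$4 * A$4$3) - A$2$3 * (A$3$2 * A$4$4 - A$3$4 * A$4$2)
             + A$2$4 * (A$3$2 * A$4$3 - A$3$3 * A$4$2))
  - A$1$2 * (A$2$1 * (A$3$3 * A$4$4 - A$3$4 * A$4$3) - A$2$3 * (A$3$1 * A$4$4 - A$3$4 * A$4$1)
             + A$2$4 * (A$3$1 * A$4$3 - A$3$3 * A$4$1))
  + A$1$3 * (A$2$1 * (A$3$2 * A$4$4 - A$3$4 * A$4$2) - A$2$2 * (A$3$1 * A$4$4 - A$3$4 * A$4$1)
             + A$2$4 * (A$3$1 * A$4$2 - A$3$2 * A$4$1))
  - A$1$4 * (A$2$1 * (A$3$2 * A$4$3 - A$3$3 * A$4$2) - A$2$2 * (A$3$1 * A$4$3 - A$3$3 * A$4$1)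
             + A$2$3 * (A$3$1 * A$4$2 - A$3$2 * A$4$1))"
proof -
  have f1234: "finite {2::4, 3, 4}" "1 \<notin> {2::4, 3, 4}" by auto
  have f234: "finite {3::4, 4}" "2 \<notin> {3::4, 4}" by auto
  have f34: "finite {4::4}" "3 \<notin> {4::4}" by auto
  show ?thesis
    unfolding det_def UNIV_4
    unfolding sum_over_permutations_insert[OF f1234]
    unfolding sum_over_permutations_insert[OF f234]
    unfolding sum_over_permutations_insert[OF f34]
    unfolding permutes_sing
    by (simp add: sign_swap_id permutation_swap_id sign_compose sign_id swap_id_eq permutation_compose)
       (simp add: algebra_simps)
qed

text \<open>The right-hand side is the Gram determinant of \<open>u\<close>, \<open>v\<close>,
  \<open>w\<close>, expanded along its first row. It appears without a sign change because the
  metric has two negative directions, hence determinant 1.\<close>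

lemma pinner_triple_prod_self:
  "pinner (triple_prod u v w) (triple_prod u v w) =
     pinner u u * (pinner v v * pinner w w - (pinner v w)\<^sup>2)
   - pinner u v * (pinner u v * pinner w w - pinner v w * pinner u w)
   + pinner u w * (pinner u v * pinner v w - pinner v v * pinner u w)"
proof -
  let ?z = "triple_prod u v w"
  have z: "pinner x ?z = det (vector [x, u, v, w] :: real^4^4)" for x
    by (rule pinner_triple_prod)
  show ?thesis
    \<comment> \<open>Testing against the standard basis gives each coordinate of \<open>?z\<close>,
      up to sign, as a 3x3 minor. What remains is a polynomial identity.\<close>
    using z[of "axis 1 1"] z[of "axis 2 1"] z[of "axis 3 1"] z[of "axis 4 1"]
    unfolding det_4
    by (simp add: pinner_def axis_def) algebra
qed

text \<open>This supplies both the algebraic rules collected in \<open>pinner_simps\<close> and the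
  product rule for derivatives of inner products.\<close>

lemma bounded_bilinear_pinner: "bounded_bilinear pinner"
  unfolding bilinear_conv_bounded_bilinear[symmetric] bilinear_def
  by (auto intro!: linearI simp: pinner_def algebra_simps)

lemmas pinner_simps =
  bounded_bilinear.add_left[OF bounded_bilinear_pinner]
  bounded_bilinear.add_right[OF bounded_bilinear_pinner]
  bounded_bilinear.diff_left[OF bounded_bilinear_pinner]
  bounded_bilinear.diff_right[OF bounded_bilinear_pinner]
  bounded_bilinear.minus_left[OF bounded_bilinear_pinner]
  bounded_bilinear.minus_right[OF bounded_bilinear_pinner]
  bounded_bilinear.scaleR_left[OF bounded_bilinear_pinner]
  bounded_bilinear.scaleR_right[OF bounded_bilinear_pinner]

lemma pinner_commute: "pinner u v = pinner v u"
  by (simp add: pinner_def)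

text \<open>Each inner product is a determinant with a repeated row.\<close>

lemma pinner_triple_prod_orthogonal:
  "pinner u (triple_prod u v w) = 0"
  "pinner v (triple_prod u v w) = 0"
  "pinner w (triple_prod u v w) = 0"
proof -
  have "det (vector [x, u, v, w] :: real^4^4) = 0" if "x \<in> {u, v, w}" for x
  proof -
    let ?A = "vector [x, u, v, w] :: real^4^4"
    have "row 1 ?A = row 2 ?A \<or> row 1 ?A = row 3 ?A \<or> row 1 ?A = row 4 ?A"
      using that by (auto simp: row_def)
    moreover have "(1::4) \<noteq> 2" "(1::4) \<noteq> 3" "(1::4) \<noteq> 4" by simp_all
    ultimately show ?thesis using det_identical_rows by metis
  qed
  then show "pinner u (triple_prod u v w) = 0" "pinner v (triple_prod u v w) = 0"
    "pinner w (triple_prod u v w) = 0"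
    by (simp_all add: pinner_triple_prod)
qed

text \<open>Nondegeneracy: only 0 is orthogonal to every vector of a basis.\<close>

lemma pinner_eq_0_imp_0:
  assumes "det (vector [t, u, v, w] :: real^4^4) \<noteq> 0"
    and "pinner t x = 0" "pinner u x = 0" "pinner v x = 0" "pinner w x = 0"
  shows "x = 0"
proof -
  let ?A = "vector [t, u, v, w] :: real^4^4"
  \<comment> \<open>\<open>y\<close> absorbs the signs of the metric, so the ordinary product of
    \<open>?A\<close> with \<open>y\<close> lists the four inner products with
    \<open>x\<close>.\<close>
  define y :: "real^4" where "y = vector [- x$1, - x$2, x$3, x$4]"
  have "?A *v y = 0"
    using assms(2-5)
    by (simp add: vec_eq_iff forall_4 matrix_vector_mult_def sum_4 y_def pinner_def)
  moreover have "invertible ?A"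
    using assms(1) by (simp add: invertible_det_nz)
  ultimately have "y = 0"
    by (meson invertible_left_inverse matrix_left_invertible_ker)
  then show ?thesis
    by (simp add: vec_eq_iff forall_4 y_def)
qed

text \<open>The four vectors have square norms -1, \<epsilon>, -\<epsilon> and 1, and \<epsilon> is
  its own inverse, which explains the signs of the coefficients. They form a basis because their
  determinant equals the square norm of the triple product.\<close>

lemma frame_expansion:
  assumes eps: "\<epsilon>\<^sup>2 = 1"
    and self: "pinner u u = -1" "pinner v v = \<epsilon>" "pinner w w = -\<epsilon>"
    and orth: "pinner u v = 0" "pinner u w = 0" "pinner v w = 0"
  shows "x = (- pinner u x) *\<^sub>R u + (\<epsilon> * pinner v x) *\<^sub>R v - (\<epsilon> * pinner w x) *\<^sub>R w
             + pinner (triple_prod u v w) x *\<^sub>R triple_prod u v w" (is "x = ?y")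
    and "pinner (triple_prod u v w) (triple_prod u v w) = 1"
proof -
  let ?t = "triple_prod u v w"
  note orth_t = pinner_triple_prod_orthogonal[where u = u and v = v and w = w]
  note orth' = orth[THEN trans[OF pinner_commute]] orth_t[THEN trans[OF pinner_commute]]
  show self_t: "pinner ?t ?t = 1"
    unfolding pinner_triple_prod_self using eps
    by (simp add: self orth power2_eq_square)
  have "\<epsilon> * c * \<epsilon> = c" for c
    using eps by (simp add: power2_eq_square algebra_simps)
  \<comment> \<open>The difference is orthogonal to all four frame vectors.\<close>
  then have "x - ?y = 0"
    by (intro pinner_eq_0_imp_0[of ?t u v w])
      (simp_all add: pinner_triple_prod[symmetric] pinner_simps self self_t orth orth_t orth')
  then show "x = ?y" by simp
qed

section \<open>The linear system that determines the total evolute\<close>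

text \<open>The two equations say that (a, b, c) is a multiple k of (l n^2, -W, -l n \<alpha>), a
  vector of square norm \<open>g\<close>. The normalisation then fixes k up to sign. The sign
  \<kappa> treats AdS3 and S32 together.\<close>

lemma evolute_coefficients:
  fixes a b c \<alpha> \<alpha>' n n' l \<epsilon> \<kappa> :: real
  defines "W \<equiv> \<alpha> * n' - n * \<alpha>'"
  defines "g \<equiv> \<epsilon> * W\<^sup>2 - l\<^sup>2 * n\<^sup>2 * (n\<^sup>2 + \<epsilon> * \<alpha>\<^sup>2)"
  assumes eps: "\<epsilon>\<^sup>2 = 1" and kappa: "\<kappa>\<^sup>2 = 1" and pos: "\<kappa> * g > 0" and n: "n \<noteq> 0"
    and norm: "- a\<^sup>2 + \<epsilon> * b\<^sup>2 - \<epsilon> * c\<^sup>2 = \<kappa>"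
  shows "\<alpha> * a + n * c = 0 \<and> n * l * b - \<alpha>' * a - n' * c = 0 \<longleftrightarrow>
    (\<exists>\<sigma>\<in>{1, -1}. a = \<sigma> / sqrt \<bar>g\<bar> * (l * n * n) \<and> b = - (\<sigma> / sqrt \<bar>g\<bar> * W) \<and>
      c = - (\<sigma> / sqrt \<bar>g\<bar> * (l * n * \<alpha>)))"
    (is "?L \<longleftrightarrow> ?R")
proof
  assume ?L
  then have c: "c = - (\<alpha> * a) / n"
    using n by (simp add: field_simps)
  \<comment> \<open>Multiply the second equation by \<open>n\<close> and eliminate
    \<open>n * c\<close> with the first.\<close>
  have ab: "n * n * l * b = - (a * W)"
    using \<open>?L\<close> unfolding W_def by algebra
  \<comment> \<open>If \<open>l\<close> is nonzero, k is read off from \<open>a\<close>. If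
    \<open>l = 0\<close>, then \<open>g\<close> reduces to \<epsilon> W^2, so \<open>W\<close> is
    nonzero; hence \<open>a = 0\<close> and k is read off from \<open>b\<close>.\<close>
  have "\<exists>k. a = k * (l * n * n) \<and> b = - (k * W)"
  proof (cases "l = 0")
    case False
    with n ab show ?thesis
      by (intro exI[of _ "a / (l * n * n)"]) (simp add: field_simps)
  next
    case True
    then have "W \<noteq> 0" using pos by (auto simp: g_def)
    with True ab show ?thesis
      by (intro exI[of _ "- b / W"]) simp
  qed
  then obtain k where k: "a = k * (l * n * n)" "b = - (k * W)" by blast
  then have k': "c = - (k * (l * n * \<alpha>))" using c n by simp
  have "k\<^sup>2 * g = \<kappa>"
    using norm unfolding k k' g_def by (simp add: algebra_simps power2_eq_square)
  then have "k\<^sup>2 * (\<kappa> * g) = 1"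
    using kappa by (simp add: power2_eq_square algebra_simps)
  \<comment> \<open>Since \<open>g\<close> has the sign \<kappa>, the previous equation becomes k^2
    |g| = 1.\<close>
  moreover have "\<bar>g\<bar> = \<kappa> * g"
    using kappa pos by (auto simp: power2_eq_1_iff)
  ultimately have "(k * sqrt \<bar>g\<bar>)\<^sup>2 = 1"
    using pos by (simp add: power_mult_distrib)
  then have "k * sqrt \<bar>g\<bar> \<in> {1, -1}"
    by (simp add: power2_eq_1_iff)
  moreover have "k = k * sqrt \<bar>g\<bar> / sqrt \<bar>g\<bar>" using pos by auto
  ultimately obtain \<sigma> where "\<sigma> \<in> {1, -1}" "k = \<sigma> / sqrt \<bar>g\<bar>" by blast
  with k k' show ?R by blast
next
  assume ?R
  then obtain k where "a = k * (l * n * n)" "b = - (k * W)" "c = - (k * (l * n * \<alpha>))"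
    by blast
  then show ?L unfolding W_def by (simp only:) (simp add: algebra_simps)
qed

section \<open>Derivatives within an interval\<close>

lemma at_within_interval_neq_bot:
  fixes I :: "real set"
  assumes "is_interval I" "interior I \<noteq> {}" "s \<in> I"
  shows "at s within I \<noteq> bot"
proof -
  \<comment> \<open>Nonempty interior excludes a one-point interval, so every point of
    \<open>I\<close>, endpoints included, is a limit point. This makes derivatives within
    \<open>I\<close> unique.\<close>
  have "I \<noteq> {x}" for x using assms(2) by auto
  then have "s islimpt I"
    using assms by (intro connected_imp_perfect is_interval_connected)
  then show ?thesis by (simp add: trivial_limit_within)
qed

lemma nth_deriv_on_1_eq:
  assumes "at s within I \<noteq> bot" "(f has_vector_derivative f') (at s within I)"
  shows "nth_deriv_on I 1 f s = f'"
  using assms by (simp add: vector_derivative_within)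

lemma nth_deriv_on_2_eq:
  assumes "at s within I \<noteq> bot" "s \<in> I"
    and "\<And>x. x \<in> I \<Longrightarrow> nth_deriv_on I 1 f x = f' x"
    and "(f' has_vector_derivative f'') (at s within I)"
  shows "nth_deriv_on I 2 f s = f''"
proof -
  have "(nth_deriv_on I 1 f has_vector_derivative f'') (at s within I)"
    using assms(2-4) by (rule has_vector_derivative_transform)
  then show ?thesis
    using assms(1) by (simp add: vector_derivative_within numeral_2_eq_2)
qed

section \<open>Coordinates in the moving frame\<close>

lemma framed_immersion_frame:
  assumes "framed_immersion I \<gamma> f1 f2" "has_curvature I \<gamma> f1 f2 \<epsilon> \<alpha> l n" "s \<in> I"
  shows "\<epsilon>\<^sup>2 = 1" "pinner (\<gamma> s) (\<gamma> s) = -1" "pinner (f1 s) (f1 s) = \<epsilon>" "pinner (f2 s) (f2 s) = - \<epsilon>"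
    "pinner (\<gamma> s) (f1 s) = 0" "pinner (\<gamma> s) (f2 s) = 0" "pinner (f1 s) (f2 s) = 0"
proof -
  have D: "(f1 s, f2 s) \<in> Delta1" and G: "\<gamma> s \<in> AdS3"
    and O: "pinner (\<gamma> s) (f1 s) = 0" "pinner (\<gamma> s) (f2 s) = 0"
    using assms(1,3) by (auto simp: framed_immersion_def)
  have e: "pinner (f1 s) (f1 s) = \<epsilon>"
    using assms(2,3) by (auto simp: has_curvature_def)
  show "\<epsilon>\<^sup>2 = 1" "pinner (\<gamma> s) (\<gamma> s) = -1" "pinner (f1 s) (f1 s) = \<epsilon>" "pinner (f2 s) (f2 s) = - \<epsilon>"
    "pinner (\<gamma> s) (f1 s) = 0" "pinner (\<gamma> s) (f2 s) = 0" "pinner (f1 s) (f2 s) = 0"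
    \<comment> \<open>The two alternatives in \<open>Delta1\<close> give \<epsilon> = -1 and
      \<epsilon> = 1, with the opposite square norm for \<open>f2\<close>.\<close>
    using D G O e by (auto simp: Delta1_def AdS3_def S32_def)
qed

lemma pinner_mu_self:
  assumes "framed_immersion I \<gamma> f1 f2" "has_curvature I \<gamma> f1 f2 \<epsilon> \<alpha> l n" "s \<in> I"
  shows "pinner (mu \<gamma> f1 f2 s) (mu \<gamma> f1 f2 s) = 1"
  unfolding mu_def by (rule frame_expansion(2)) (fact framed_immersion_frame[OF assms])+

text \<open>\<open>height\<close> is the mu-coefficient of \<open>v\<close>, and the other
  coefficients are determined by inner products. An existential claim about coefficients thus
  becomes a system of equations for fixed numbers.\<close>

lemma combination_iff:
  assumes "framed_immersion I \<gamma> f1 f2" "has_curvature I \<gamma> f1 f2 \<epsilon> \<alpha> l n" "s \<in> I"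
  shows "v = a *\<^sub>R \<gamma> s + b *\<^sub>R f1 s + c *\<^sub>R f2 s \<longleftrightarrow>
    height \<gamma> f1 f2 s v = 0 \<and> a = - pinner (\<gamma> s) v \<and> b = \<epsilon> * pinner (f1 s) v \<and> c = - (\<epsilon> * pinner (f2 s) v)"
    (is "?L \<longleftrightarrow> ?R")
proof
  note F = framed_immersion_frame[OF assms]
  note F' = F(5-7)[THEN trans[OF pinner_commute]]
    pinner_triple_prod_orthogonal[THEN trans[OF pinner_commute]]
  have e: "\<epsilon> * (b * \<epsilon>) = b" for b using F(1) by (simp add: power2_eq_square algebra_simps)
  assume ?L
  then show ?R
    by (simp add: height_def mu_def pinner_simps F F' e)
next
  note F = framed_immersion_frame[OF assms]
  assume ?R
  then show ?L
    using frame_expansion(1)[OF F, of v] by (simp add: height_def mu_def)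
qed

lemma pinner_combination:
  assumes "framed_immersion I \<gamma> f1 f2" "has_curvature I \<gamma> f1 f2 \<epsilon> \<alpha> l n" "s \<in> I"
    and "v = a *\<^sub>R \<gamma> s + b *\<^sub>R f1 s + c *\<^sub>R f2 s"
  shows "pinner v v = - a\<^sup>2 + \<epsilon> * b\<^sup>2 - \<epsilon> * c\<^sup>2"
proof -
  note F = framed_immersion_frame[OF assms(1-3)]
  show ?thesis
    unfolding assms(4)
    by (simp add: pinner_simps F F(5-7)[THEN trans[OF pinner_commute]] power2_eq_square)
qed

section \<open>Derivatives of the curvature and of the height function\<close>

text \<open>Smoothness is assumed for the frame only. It passes to the curvature because \<alpha>
  and \<open>n\<close> are the inner products of mu with the derivatives of \<gamma> and
  \<open>f2\<close>, mu being a unit vector orthogonal to \<open>f1\<close>.\<close>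

lemma curvature_differentiable:
  assumes "is_interval I" "interior I \<noteq> {}"
    and imm: "framed_immersion I \<gamma> f1 f2" and curv: "has_curvature I \<gamma> f1 f2 \<epsilon> \<alpha> l n"
    and s: "s \<in> I"
  shows "(\<alpha> has_vector_derivative nth_deriv_on I 1 \<alpha> s) (at s within I)"
    and "(n has_vector_derivative nth_deriv_on I 1 n s) (at s within I)"
proof -
  let ?m = "mu \<gamma> f1 f2"
  let ?T = "\<lambda>s. (\<gamma> s, f1 s, f2 s)"
  let ?T' = "\<lambda>s. (\<alpha> s *\<^sub>R ?m s, l s *\<^sub>R f2 s, l s *\<^sub>R f1 s + n s *\<^sub>R ?m s)"
  have "nth_deriv_on I 1 ?T x = ?T' x" if "x \<in> I" for x
    using curv that
    by (intro nth_deriv_on_1_eq at_within_interval_neq_bot assms has_vector_derivative_Pair)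
      (auto simp: has_curvature_def)
  moreover have "nth_deriv_on I 1 ?T differentiable at s within I"
    using imm s unfolding framed_immersion_def smooth_map_on_def by blast
  \<comment> \<open>\<open>?T'\<close> agrees on \<open>I\<close> with the derivative of the frame,
    which is itself differentiable.\<close>
  ultimately have "?T' differentiable at s within I"
    using s by (auto intro: differentiable_transform_within[of "nth_deriv_on I 1 ?T" s I 1])
  then obtain T'' where T'': "(?T' has_vector_derivative T'') (at s within I)"
    by (meson vector_derivative_works)
  have m: "(?m has_vector_derivative \<alpha> s *\<^sub>R \<gamma> s + (\<epsilon> * n s) *\<^sub>R f2 s) (at s within I)"
    using curv s by (simp add: has_curvature_def)
  have G: "((\<lambda>s. fst (?T' s)) has_vector_derivative fst T'') (at s within I)"
    by (rule bounded_linear.has_vector_derivative[OF bounded_linear_fst T''])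
  have F: "((\<lambda>s. snd (snd (?T' s))) has_vector_derivative snd (snd T'')) (at s within I)"
    by (intro bounded_linear.has_vector_derivative[OF bounded_linear_snd] T'')
  \<comment> \<open>The product rule applies to mu paired with the first and third components of
    \<open>?T'\<close>; on \<open>I\<close> these pairings are \<alpha> and
    \<open>n\<close>.\<close>
  note prod = bounded_bilinear.has_vector_derivative[OF bounded_bilinear_pinner m]
  have orth: "pinner (?m x) (f1 x) = 0" for x
    by (metis mu_def pinner_commute pinner_triple_prod_orthogonal(2))
  have "\<exists>\<alpha>'. (\<alpha> has_vector_derivative \<alpha>') (at s within I)"
    by (rule exI, rule has_vector_derivative_transform[OF s _ prod[OF G]])
      (simp add: pinner_simps pinner_mu_self[OF imm curv])
  moreover have "\<exists>n'. (n has_vector_derivative n') (at s within I)"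
    by (rule exI, rule has_vector_derivative_transform[OF s _ prod[OF F]])
      (simp add: pinner_simps orth pinner_mu_self[OF imm curv])
  moreover have "at s within I \<noteq> bot"
    using assms by (intro at_within_interval_neq_bot)
  ultimately show "(\<alpha> has_vector_derivative nth_deriv_on I 1 \<alpha> s) (at s within I)"
    and "(n has_vector_derivative nth_deriv_on I 1 n s) (at s within I)"
    using nth_deriv_on_1_eq by metis+
qed

text \<open>Both formulas come from inserting the frame equations. In the second derivative, the
  mu-parts of the derivatives of \<gamma> and \<open>f2\<close> combine into a multiple of
  \<open>height\<close> itself, which drops out where \<open>height\<close> vanishes.\<close>

lemma nth_deriv_on_height:
  assumes "is_interval I" "interior I \<noteq> {}"
    and imm: "framed_immersion I \<gamma> f1 f2" and curv: "has_curvature I \<gamma> f1 f2 \<epsilon> \<alpha> l n"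
    and s: "s \<in> I"
  shows "nth_deriv_on I 1 (\<lambda>s. height \<gamma> f1 f2 s v) s =
      \<alpha> s * pinner (\<gamma> s) v + \<epsilon> * n s * pinner (f2 s) v"
    and "nth_deriv_on I 2 (\<lambda>s. height \<gamma> f1 f2 s v) s =
      nth_deriv_on I 1 \<alpha> s * pinner (\<gamma> s) v + \<epsilon> * nth_deriv_on I 1 n s * pinner (f2 s) v
      + \<epsilon> * n s * l s * pinner (f1 s) v + ((\<alpha> s)\<^sup>2 + \<epsilon> * (n s)\<^sup>2) * height \<gamma> f1 f2 s v"
proof -
  let ?m = "mu \<gamma> f1 f2"
  let ?h = "\<lambda>s. height \<gamma> f1 f2 s v"
  let ?h' = "\<lambda>s. \<alpha> s * pinner (\<gamma> s) v + \<epsilon> * n s * pinner (f2 s) v"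
  note pinner_v = bounded_linear.has_vector_derivative
    [OF bounded_bilinear.bounded_linear_left[OF bounded_bilinear_pinner, of v]]
  have d:
    "(\<gamma> has_vector_derivative \<alpha> x *\<^sub>R ?m x) (at x within I)"
    "(f2 has_vector_derivative l x *\<^sub>R f1 x + n x *\<^sub>R ?m x) (at x within I)"
    "(?m has_vector_derivative \<alpha> x *\<^sub>R \<gamma> x + (\<epsilon> * n x) *\<^sub>R f2 x) (at x within I)"
    if "x \<in> I" for x
    using curv that by (auto simp: has_curvature_def)
  have bot: "at x within I \<noteq> bot" if "x \<in> I" for x
    using assms that by (intro at_within_interval_neq_bot)
  have h': "nth_deriv_on I 1 ?h x = ?h' x" if "x \<in> I" for x
    using nth_deriv_on_1_eq[OF bot[OF that] pinner_v[OF d(3)[OF that]]]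
    by (simp add: height_def pinner_simps)
  from h'[OF s] show "nth_deriv_on I 1 ?h s = ?h' s" .
  note c = curvature_differentiable[OF assms]
  show "nth_deriv_on I 2 ?h s =
      nth_deriv_on I 1 \<alpha> s * pinner (\<gamma> s) v + \<epsilon> * nth_deriv_on I 1 n s * pinner (f2 s) v
      + \<epsilon> * n s * l s * pinner (f1 s) v + ((\<alpha> s)\<^sup>2 + \<epsilon> * (n s)\<^sup>2) * ?h s"
  proof (rule nth_deriv_on_2_eq[OF bot[OF s] s h'])
    show "(?h' has_vector_derivative
      nth_deriv_on I 1 \<alpha> s * pinner (\<gamma> s) v + \<epsilon> * nth_deriv_on I 1 n s * pinner (f2 s) v
      + \<epsilon> * n s * l s * pinner (f1 s) v + ((\<alpha> s)\<^sup>2 + \<epsilon> * (n s)\<^sup>2) * ?h s) (at s within I)"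
      by (rule has_vector_derivative_eq_rhs,
          (rule has_vector_derivative_add has_vector_derivative_mult has_vector_derivative_const
            c pinner_v[OF d(1)[OF s]] pinner_v[OF d(2)[OF s]])+)
        (simp add: height_def pinner_simps power2_eq_square algebra_simps)
  qed
qed

section \<open>Zeros of the height function and its first two derivatives\<close>

text \<open>The value \<kappa> = -1 gives the AdS3 case with \<open>g\<close> negative, and \<kappa>
  = 1 the S32 case with \<open>g\<close> positive.\<close>

lemma height_zeros:
  assumes "is_interval I" "interior I \<noteq> {}"
    and imm: "framed_immersion I \<gamma> f1 f2" and curv: "has_curvature I \<gamma> f1 f2 \<epsilon> \<alpha> l n"
    and s: "s \<in> I" and n: "n s \<noteq> 0"
    and kappa: "\<kappa>\<^sup>2 = 1" and pos: "\<kappa> * g_fun I \<epsilon> \<alpha> l n s > 0" and v: "pinner v v = \<kappa>"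
  shows
    "height \<gamma> f1 f2 s v = 0 \<longleftrightarrow>
      (\<exists>a b c. v = a *\<^sub>R \<gamma> s + b *\<^sub>R f1 s + c *\<^sub>R f2 s \<and> - a\<^sup>2 + \<epsilon> * b\<^sup>2 - \<epsilon> * c\<^sup>2 = \<kappa>)"
      (is ?A)
    and "height \<gamma> f1 f2 s v = 0 \<and> nth_deriv_on I 1 (\<lambda>s. height \<gamma> f1 f2 s v) s = 0 \<longleftrightarrow>
      (\<exists>a b. v = a *\<^sub>R \<gamma> s + b *\<^sub>R f1 s - (a * \<alpha> s / n s) *\<^sub>R f2 s \<and>
        (n s)\<^sup>2 * (\<epsilon> * b\<^sup>2 - \<kappa>) = a\<^sup>2 * ((n s)\<^sup>2 + \<epsilon> * (\<alpha> s)\<^sup>2))"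
      (is ?B)
    and "height \<gamma> f1 f2 s v = 0 \<and> nth_deriv_on I 1 (\<lambda>s. height \<gamma> f1 f2 s v) s = 0 \<and>
        nth_deriv_on I 2 (\<lambda>s. height \<gamma> f1 f2 s v) s = 0 \<longleftrightarrow>
      (\<exists>\<sigma>\<in>{1, -1}. v = total_evolute I \<sigma> \<epsilon> \<gamma> f1 f2 \<alpha> l n s)"
      (is ?C)
proof -
  \<comment> \<open>By \<open>combination_iff\<close>, these are the only possible witnesses for the
    coefficients.\<close>
  define a b c where abc: "a = - pinner (\<gamma> s) v" "b = \<epsilon> * pinner (f1 s) v"
    "c = - (\<epsilon> * pinner (f2 s) v)"
  note comb = combination_iff[OF imm curv s, of v, folded abc]
  note eps = framed_immersion_frame(1)[OF imm curv s]
  note deriv = nth_deriv_on_height[OF assms(1-5), of v]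
  let ?h = "height \<gamma> f1 f2 s v"
  let ?g = "g_fun I \<epsilon> \<alpha> l n s"
  let ?W = "\<alpha> s * nth_deriv_on I 1 n s - n s * nth_deriv_on I 1 \<alpha> s"
  have norm: "- a\<^sup>2 + \<epsilon> * b\<^sup>2 - \<epsilon> * c\<^sup>2 = \<kappa>" if "?h = 0"
    using pinner_combination[OF imm curv s, of v a b c] comb[of a b c] that v by simp
  show ?A using norm comb by blast
  have h': "nth_deriv_on I 1 (\<lambda>s. height \<gamma> f1 f2 s v) s = 0 \<longleftrightarrow> c = - (a * \<alpha> s / n s)"
    unfolding deriv abc using n by (auto simp: field_simps)
  \<comment> \<open>This is the normalisation with \<open>c\<close> eliminated and the denominator
    \<open>n s\<close> cleared.\<close>
  have norm': "(n s)\<^sup>2 * (\<epsilon> * b\<^sup>2 - \<kappa>) = a\<^sup>2 * ((n s)\<^sup>2 + \<epsilon> * (\<alpha> s)\<^sup>2)"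
    if "?h = 0" "c = - (a * \<alpha> s / n s)"
  proof -
    have "n s * c = - (a * \<alpha> s)" using that n by simp
    then show ?thesis using norm[OF that(1)] by algebra
  qed
  have "v = x *\<^sub>R \<gamma> s + y *\<^sub>R f1 s - (x * \<alpha> s / n s) *\<^sub>R f2 s \<longleftrightarrow>
    ?h = 0 \<and> x = a \<and> y = b \<and> - (x * \<alpha> s / n s) = c" for x y
    using comb[of x y "- (x * \<alpha> s / n s)"] by simp
  with norm' h' show ?B by auto
  \<comment> \<open>On the zero set of \<open>height\<close>, the derivatives reduce to the system
    solved in \<open>evolute_coefficients\<close>, up to an overall sign in the first
    equation.\<close>
  have h'': "nth_deriv_on I 1 (\<lambda>s. height \<gamma> f1 f2 s v) s = 0 \<and>
      nth_deriv_on I 2 (\<lambda>s. height \<gamma> f1 f2 s v) s = 0 \<longleftrightarrow>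
    \<alpha> s * a + n s * c = 0 \<and> n s * l s * b - nth_deriv_on I 1 \<alpha> s * a - nth_deriv_on I 1 n s * c = 0"
    if "?h = 0"
    unfolding deriv abc that by (auto simp: algebra_simps)
  have g: "?g = \<epsilon> * ?W\<^sup>2 - (l s)\<^sup>2 * (n s)\<^sup>2 * ((n s)\<^sup>2 + \<epsilon> * (\<alpha> s)\<^sup>2)"
    by (simp add: g_fun_def)
  note coeff = evolute_coefficients[OF eps kappa pos[unfolded g] n norm, folded g]
  \<comment> \<open>The evolute is a combination of \<gamma>, \<open>f1\<close> and
    \<open>f2\<close> without mu-part, so equality with it amounts to \<open>height\<close> being
    zero and a comparison of coefficients.\<close>
  have evolute: "v = total_evolute I \<sigma> \<epsilon> \<gamma> f1 f2 \<alpha> l n s \<longleftrightarrow>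
    ?h = 0 \<and> a = \<sigma> / sqrt \<bar>?g\<bar> * (l s * n s * n s) \<and> b = - (\<sigma> / sqrt \<bar>?g\<bar> * ?W) \<and>
    c = - (\<sigma> / sqrt \<bar>?g\<bar> * (l s * n s * \<alpha> s))" for \<sigma>
  proof -
    define k where "k = \<sigma> / sqrt \<bar>?g\<bar>"
    have "total_evolute I \<sigma> \<epsilon> \<gamma> f1 f2 \<alpha> l n s =
      (k * (l s * n s * n s)) *\<^sub>R \<gamma> s + (- (k * ?W)) *\<^sub>R f1 s + (- (k * (l s * n s * \<alpha> s))) *\<^sub>R f2 s"
      unfolding total_evolute_def k_def[symmetric]
      by (simp add: scaleR_diff_right mult.assoc)
    then show ?thesis
      unfolding k_def[symmetric] using comb by (simp only:) blast
  qed
  show ?C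
  proof (cases "?h = 0")
    case True
    show ?thesis
      by (simp only: True h''[OF True] coeff[OF True] evolute simp_thms)
  next
    case False
    then show ?thesis unfolding evolute by simp
  qed
qed

theorem proposition4p9:
  fixes I :: "real set"
    and \<gamma> f1 f2 :: "real \<Rightarrow> real^4"
    and \<alpha> l n :: "real \<Rightarrow> real"
    and \<epsilon> s0 :: real
  assumes "is_interval I" and "interior I \<noteq> {}"
    and "framed_immersion I \<gamma> f1 f2"
    and "has_curvature I \<gamma> f1 f2 \<epsilon> \<alpha> l n"
    and "\<forall>s\<in>I. n s \<noteq> 0"
    and "\<forall>s\<in>I. (\<alpha> s)\<^sup>2 + \<epsilon> * (n s)\<^sup>2 \<noteq> 0"
    and "\<forall>s\<in>I. g_fun I \<epsilon> \<alpha> l n s \<noteq> 0"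
    and "s0 \<in> I"
  shows
    "(g_fun I \<epsilon> \<alpha> l n s0 < 0 \<longrightarrow> (\<forall>v0\<in>AdS3.
        (height \<gamma> f1 f2 s0 v0 = 0 \<longleftrightarrow>
          (\<exists>a b c. v0 = a *\<^sub>R \<gamma> s0 + b *\<^sub>R f1 s0 + c *\<^sub>R f2 s0 \<and>
                   - a\<^sup>2 + \<epsilon> * b\<^sup>2 - \<epsilon> * c\<^sup>2 = -1)) \<and>
        (height \<gamma> f1 f2 s0 v0 = 0 \<and>
         nth_deriv_on I 1 (\<lambda>s. height \<gamma> f1 f2 s v0) s0 = 0 \<longleftrightarrow>
          (\<exists>a b. v0 = a *\<^sub>R \<gamma> s0 + b *\<^sub>R f1 s0 - (a * \<alpha> s0 / n s0) *\<^sub>R f2 s0 \<and>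
                 (n s0)\<^sup>2 * (1 + \<epsilon> * b\<^sup>2) = a\<^sup>2 * ((n s0)\<^sup>2 + \<epsilon> * (\<alpha> s0)\<^sup>2))) \<and>
        (height \<gamma> f1 f2 s0 v0 = 0 \<and>
         nth_deriv_on I 1 (\<lambda>s. height \<gamma> f1 f2 s v0) s0 = 0 \<and>
         nth_deriv_on I 2 (\<lambda>s. height \<gamma> f1 f2 s v0) s0 = 0 \<longleftrightarrow>
          (\<exists>\<sigma>\<in>{1, -1}. v0 = total_evolute I \<sigma> \<epsilon> \<gamma> f1 f2 \<alpha> l n s0)))) \<and>
     (g_fun I \<epsilon> \<alpha> l n s0 > 0 \<longrightarrow> (\<forall>v0\<in>S32.
        (height \<gamma> f1 f2 s0 v0 = 0 \<longleftrightarrow>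
          (\<exists>a b c. v0 = a *\<^sub>R \<gamma> s0 + b *\<^sub>R f1 s0 + c *\<^sub>R f2 s0 \<and>
                   - a\<^sup>2 + \<epsilon> * b\<^sup>2 - \<epsilon> * c\<^sup>2 = 1)) \<and>
        (height \<gamma> f1 f2 s0 v0 = 0 \<and>
         nth_deriv_on I 1 (\<lambda>s. height \<gamma> f1 f2 s v0) s0 = 0 \<longleftrightarrow>
          (\<exists>a b. v0 = a *\<^sub>R \<gamma> s0 + b *\<^sub>R f1 s0 - (a * \<alpha> s0 / n s0) *\<^sub>R f2 s0 \<and>
                 (n s0)\<^sup>2 * (\<epsilon> * b\<^sup>2 - 1) = a\<^sup>2 * ((n s0)\<^sup>2 + \<epsilon> * (\<alpha> s0)\<^sup>2))) \<and>
        (\<epsilon> = -1 \<longrightarrow> (n s0)\<^sup>2 < (\<alpha> s0)\<^sup>2) \<and>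
        (height \<gamma> f1 f2 s0 v0 = 0 \<and>
         nth_deriv_on I 1 (\<lambda>s. height \<gamma> f1 f2 s v0) s0 = 0 \<and>
         nth_deriv_on I 2 (\<lambda>s. height \<gamma> f1 f2 s v0) s0 = 0 \<longleftrightarrow>
          (\<exists>\<sigma>\<in>{1, -1}. v0 = total_evolute I \<sigma> \<epsilon> \<gamma> f1 f2 \<alpha> l n s0))))"
proof (intro conjI impI ballI)
  note zeros = height_zeros[OF assms(1-4,8) bspec[OF assms(5,8)]]
  let ?g = "g_fun I \<epsilon> \<alpha> l n s0"
  fix v0
  {
    assume "?g < 0" "v0 \<in> AdS3"
    \<comment> \<open>The premises of \<open>height_zeros\<close> for \<kappa> = -1.\<close>
    then have "(-1)\<^sup>2 = (1::real)" "(-1) * ?g > 0" "pinner v0 v0 = -1"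
      by (simp_all add: AdS3_def)
    note Z = zeros[OF this]
    show "height \<gamma> f1 f2 s0 v0 = 0 \<longleftrightarrow>
          (\<exists>a b c. v0 = a *\<^sub>R \<gamma> s0 + b *\<^sub>R f1 s0 + c *\<^sub>R f2 s0 \<and>
                   - a\<^sup>2 + \<epsilon> * b\<^sup>2 - \<epsilon> * c\<^sup>2 = -1)"
      by (rule Z(1))
    show "height \<gamma> f1 f2 s0 v0 = 0 \<and>
         nth_deriv_on I 1 (\<lambda>s. height \<gamma> f1 f2 s v0) s0 = 0 \<longleftrightarrow>
          (\<exists>a b. v0 = a *\<^sub>R \<gamma> s0 + b *\<^sub>R f1 s0 - (a * \<alpha> s0 / n s0) *\<^sub>R f2 s0 \<and>
                 (n s0)\<^sup>2 * (1 + \<epsilon> * b\<^sup>2) = a\<^sup>2 * ((n s0)\<^sup>2 + \<epsilon> * (\<alpha> s0)\<^sup>2))"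
      using Z(2) by (simp only: diff_minus_eq_add add.commute)
    show "height \<gamma> f1 f2 s0 v0 = 0 \<and>
         nth_deriv_on I 1 (\<lambda>s. height \<gamma> f1 f2 s v0) s0 = 0 \<and>
         nth_deriv_on I 2 (\<lambda>s. height \<gamma> f1 f2 s v0) s0 = 0 \<longleftrightarrow>
          (\<exists>\<sigma>\<in>{1, -1}. v0 = total_evolute I \<sigma> \<epsilon> \<gamma> f1 f2 \<alpha> l n s0)"
      by (rule Z(3))
  }
  assume pos: "0 < ?g"
  {
    assume "v0 \<in> S32"
    with pos have "1\<^sup>2 = (1::real)" "1 * ?g > 0" "pinner v0 v0 = 1"
      by (simp_all add: S32_def)
    note Z = zeros[OF this]
    show "height \<gamma> f1 f2 s0 v0 = 0 \<longleftrightarrow>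
          (\<exists>a b c. v0 = a *\<^sub>R \<gamma> s0 + b *\<^sub>R f1 s0 + c *\<^sub>R f2 s0 \<and>
                   - a\<^sup>2 + \<epsilon> * b\<^sup>2 - \<epsilon> * c\<^sup>2 = 1)"
      by (rule Z(1))
    show "height \<gamma> f1 f2 s0 v0 = 0 \<and>
         nth_deriv_on I 1 (\<lambda>s. height \<gamma> f1 f2 s v0) s0 = 0 \<longleftrightarrow>
          (\<exists>a b. v0 = a *\<^sub>R \<gamma> s0 + b *\<^sub>R f1 s0 - (a * \<alpha> s0 / n s0) *\<^sub>R f2 s0 \<and>
                 (n s0)\<^sup>2 * (\<epsilon> * b\<^sup>2 - 1) = a\<^sup>2 * ((n s0)\<^sup>2 + \<epsilon> * (\<alpha> s0)\<^sup>2))"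
      by (rule Z(2))
    show "height \<gamma> f1 f2 s0 v0 = 0 \<and>
         nth_deriv_on I 1 (\<lambda>s. height \<gamma> f1 f2 s v0) s0 = 0 \<and>
         nth_deriv_on I 2 (\<lambda>s. height \<gamma> f1 f2 s v0) s0 = 0 \<longleftrightarrow>
          (\<exists>\<sigma>\<in>{1, -1}. v0 = total_evolute I \<sigma> \<epsilon> \<gamma> f1 f2 \<alpha> l n s0)"
      by (rule Z(3))
  }
  show "(n s0)\<^sup>2 < (\<alpha> s0)\<^sup>2" if "\<epsilon> = -1"
  \<comment> \<open>For \<epsilon> = -1, \<open>g\<close> is minus a square minus l^2 n^2 (n^2 -
    \<alpha>^2). If n^2 were at least \<alpha>^2, \<open>g\<close> could not be positive.\<close>
  proof (rule ccontr)
    assume "\<not> (n s0)\<^sup>2 < (\<alpha> s0)\<^sup>2"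
    then have "(l s0)\<^sup>2 * (n s0)\<^sup>2 * ((n s0)\<^sup>2 + - 1 * (\<alpha> s0)\<^sup>2) \<ge> 0" by simp
    moreover have "(\<alpha> s0 * nth_deriv_on I 1 n s0 - n s0 * nth_deriv_on I 1 \<alpha> s0)\<^sup>2 \<ge> 0"
      by (rule zero_le_power2)
    ultimately show False
      using pos unfolding g_fun_def \<open>\<epsilon> = -1\<close> by linarith
  qed
qed

end
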